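(* The upload cost of user $v_i$ in the GroupRR mechanism is $$O\left(\left(\frac{d_i}{s}+\frac{n}{s^2(e^{\varepsilon_1}-1)}\right)\log\frac ns\right).$$
   Context: $G=(V,E)$ is a simple graph on users $v_1,\dots,v_n$, assumed sparse ($|E|$ much smaller than $|V|^2$); $a_{i,j}=1$ if $\{v_i,v_j\}\in E$ and $0$ otherwise, and $d_i=|\{j<i:a_{i,j}=1\}|$. Parameters: a privacy budget $\varepsilon_1>0$, a positive integer $s$ (the sampling size), $p$ the smallest prime larger than $n$, $m=\lceil p/s\rceil$ (so $m\approx n/s$), and $\varepsilon'=\ln(1+s(e^{\varepsilon_1}-1))$. In the group randomized response step of the GroupRR mechanism, user $v_i$ partitions the users, by the public random hash function $h_i(j)=((\theta_i j+\phi_i)\bmod p)\bmod m$ with $(\theta_i,\phi_i)$ drawn at random from $\{1,\dots,p-1\}\times\{0,\dots,p-1\}$, into $m$ groups $S_{i,t}=\{v_j:h_i(j)=t\}$, padded with dummy non-neighbours so that every group has size $s$, and draws from each group one representative $v_{c_t}$, each member being chosen with probability $1/s$. The bit $a_{i,c_t}$ (replaced by $0$ if $c_t>i$, and equal to $0$ for a dummy) is passed through randomized response: the published bit $a'_{i,c_t}$ equals the input bit with probability $\frac{e^{\varepsilon'}}{1+e^{\varepsilon'}}$ and its complement with probability $\frac{1}{1+e^{\varepsilon'}}$. User $v_i$ uploads the list of indices $\{t:a'_{i,c_t}=1\}$, at a cost of $\log m\approx\log(n/s)$ bits per listed index. The upload cost of $v_i$ is the average (expected) number of bits $v_i$ sends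 to the server; the costs of the other steps of the mechanism are disregarded.
   Formalization: The bound is proved for n ≥ c·s with any fixed c > 1, the constant depending only on c; without this it fails, since at n = s the right-hand side is 0 (log(n/s) = 0) while m = 2 and the expected upload cost is positive. *)

theory Defs
  imports "HOL-Probability.Probability" "HOL-Number_Theory.Cong" "HOL-Computational_Algebra.Primes"
begin

text \<open>Users \<open>v\<^sub>1, \<dots>, v\<^sub>n\<close> are represented by their indices \<open>1, \<dots>, n\<close>.\<close>

definition simple_graph :: "nat \<Rightarrow> nat set set \<Rightarrow> bool" where
  "simple_graph n E \<longleftrightarrow> E \<subseteq> {{u, v} | u v. u \<in> {1..n} \<and> v \<in> {1..n} \<and> u \<noteq> v}"

definition adj :: "nat set set \<Rightarrow> nat \<Rightarrow> nat \<Rightarrow> bool" where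
  "adj E i j \<longleftrightarrow> {i, j} \<in> E"

definition low_degree :: "nat set set \<Rightarrow> nat \<Rightarrow> nat" where
  "low_degree E i = card {j \<in> {1..<i}. adj E i j}"

definition next_prime :: "nat \<Rightarrow> nat" where
  "next_prime n = (LEAST p. prime p \<and> n < p)"

definition num_groups :: "nat \<Rightarrow> nat \<Rightarrow> nat" where
  "num_groups n s = nat \<lceil>real (next_prime n) / real s\<rceil>"

text \<open>Keeping one member out of \<open>s\<close> amplifies privacy, so that responding with the larger budget
  \<open>\<epsilon>'\<close> satisfying \<open>exp \<epsilon>' - 1 = s * (exp \<epsilon>\<^sub>1 - 1)\<close> costs only \<open>\<epsilon>\<^sub>1\<close>.\<close>

definition rr_budget :: "nat \<Rightarrow> real \<Rightarrow> real" where
  "rr_budget s \<epsilon>\<^sub>1 = ln (1 + real s * (exp \<epsilon>\<^sub>1 - 1))"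

definition group_hash :: "nat \<Rightarrow> nat \<Rightarrow> nat \<times> nat \<Rightarrow> nat \<Rightarrow> nat" where
  "group_hash n s = (\<lambda>(\<theta>, \<phi>) j. ((\<theta> * j + \<phi>) mod next_prime n) mod num_groups n s)"

definition hash_seed :: "nat \<Rightarrow> (nat \<times> nat) pmf" where
  "hash_seed n = pmf_of_set ({1..next_prime n - 1} \<times> {0..next_prime n - 1})"

definition user_group :: "nat \<Rightarrow> nat \<Rightarrow> nat \<times> nat \<Rightarrow> nat \<Rightarrow> nat set" where
  "user_group n s k t = {j \<in> {1..n}. group_hash n s k j = t}"

datatype member = User nat | Dummy nat

definition padded_group :: "nat \<Rightarrow> nat \<Rightarrow> nat \<times> nat \<Rightarrow> nat \<Rightarrow> member set" where
  "padded_group n s k t =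
     User ` user_group n s k t \<union> Dummy ` {..<s - card (user_group n s k t)}"

fun input_bit :: "nat set set \<Rightarrow> nat \<Rightarrow> member \<Rightarrow> bool" where
  "input_bit E i (User j) \<longleftrightarrow> j \<le> i \<and> adj E i j"
| "input_bit E i (Dummy k) \<longleftrightarrow> False"

definition randomized_response :: "real \<Rightarrow> bool \<Rightarrow> bool pmf" where
  "randomized_response \<epsilon> b =
     map_pmf (\<lambda>keep. if keep then b else \<not> b) (bernoulli_pmf (exp \<epsilon> / (1 + exp \<epsilon>)))"

definition published_bit ::
  "nat \<Rightarrow> nat \<Rightarrow> real \<Rightarrow> nat set set \<Rightarrow> nat \<Rightarrow> nat \<times> nat \<Rightarrow> nat \<Rightarrow> bool pmf" where
  "published_bit n s \<epsilon>\<^sub>1 E i k t = do {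
     c \<leftarrow> pmf_of_set (padded_group n s k t);
     randomized_response (rr_budget s \<epsilon>\<^sub>1) (input_bit E i c)
   }"

text \<open>The list of indices uploaded by user \<open>i\<close>; the hash seed is drawn once, the representatives
  and response bits of different groups are drawn independently given the seed.\<close>

definition upload :: "nat \<Rightarrow> nat \<Rightarrow> real \<Rightarrow> nat set set \<Rightarrow> nat \<Rightarrow> nat list pmf" where
  "upload n s \<epsilon>\<^sub>1 E i = do {
     k \<leftarrow> hash_seed n;
     a' \<leftarrow> Pi_pmf {..<num_groups n s} False (published_bit n s \<epsilon>\<^sub>1 E i k);
     return_pmf (filter a' [0..<num_groups n s])
   }"

text \<open>Expected number of uploaded bits, with base-2 logarithm of the number \<open>m\<close> of groups per listed
  index, not rounded up to an integer.\<close>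

definition upload_cost :: "nat \<Rightarrow> nat \<Rightarrow> real \<Rightarrow> nat set set \<Rightarrow> nat \<Rightarrow> real" where
  "upload_cost n s \<epsilon>\<^sub>1 E i =
     measure_pmf.expectation (upload n s \<epsilon>\<^sub>1 E i)
       (\<lambda>ts. real (length ts) * log 2 (real (num_groups n s)))"

lemma next_prime: "prime (next_prime n)" "n < next_prime n"
proof -
  obtain q where "prime q \<and> n < q" using bigger_prime by blast
  then have "prime (next_prime n) \<and> n < next_prime n"
    unfolding next_prime_def by (rule LeastI)
  then show "prime (next_prime n)" "n < next_prime n" by auto
qed

text \<open>A hash group never has more than \<open>s\<close> users, so the truncated subtraction in
  \<open>padded_group\<close> is harmless and every padded group has exactly \<open>s\<close> members.\<close>

lemma card_user_group_le:
  assumes s: "s > 0" and k: "k \<in> {1..next_prime n - 1} \<times> {0..next_prime n - 1}"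
  shows "card (user_group n s k t) \<le> s"
proof -
  obtain \<theta> \<phi> where k_eq: "k = (\<theta>, \<phi>)" by (cases k)
  define p where "p = next_prime n"
  define m where "m = num_groups n s"
  define g where "g j = (\<theta> * j + \<phi>) mod p" for j
  have p: "prime p" "n < p" using next_prime[of n] by (auto simp: p_def)
  then have p0: "p > 0" by (simp add: prime_gt_0_nat)
  have \<theta>: "0 < \<theta>" "\<theta> < p" using k p0 by (auto simp: k_eq p_def)
  have cop: "coprime \<theta> p"
    using p \<theta> by (metis coprime_commute nat_dvd_not_less prime_imp_coprime)
  have "real p / real s \<le> real m"
    unfolding m_def num_groups_def p_def by linarith
  then have "real p \<le> real (m * s)" using s by (simp add: field_simps)
  then have pms: "p \<le> m * s" using of_nat_le_iff by blast
  have inj: "inj_on g {1..n}"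
  proof (rule inj_onI)
    fix x y assume xy: "x \<in> {1..n}" "y \<in> {1..n}" "g x = g y"
    then have "[\<theta> * x = \<theta> * y] (mod p)"
      by (simp add: g_def cong_def [symmetric] cong_add_rcancel_nat)
    then have "[x = y] (mod p)" using cop cong_mult_lcancel_nat by blast
    then show "x = y" using xy p(2) by (simp add: cong_def)
  qed
  have "inj_on (\<lambda>j. g j div m) (user_group n s k t)"
  proof (rule inj_onI)
    fix x y assume xy: "x \<in> user_group n s k t" "y \<in> user_group n s k t"
      and "g x div m = g y div m"
    moreover have "g x mod m = g y mod m"
      using xy by (auto simp: user_group_def group_hash_def k_eq g_def p_def m_def)
    ultimately have "g x = g y" by (metis div_mult_mod_eq)
    then show "x = y" using inj xy by (auto simp: user_group_def dest: inj_onD)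
  qed
  moreover have "(\<lambda>j. g j div m) ` user_group n s k t \<subseteq> {..<s}"
  proof -
    have "g j div m < s" for j
      using p0 pms mod_less_divisor[OF p0, of "\<theta> * j + \<phi>"]
      by (intro less_mult_imp_div_less) (simp add: g_def mult.commute)
    then show ?thesis by auto
  qed
  ultimately show ?thesis by (metis card_inj_on_le card_lessThan finite_lessThan)
qed

lemma card_padded_group:
  assumes "s > 0" "k \<in> {1..next_prime n - 1} \<times> {0..next_prime n - 1}"
  shows "card (padded_group n s k t) = s"
proof -
  have "finite (user_group n s k t)" by (simp add: user_group_def)
  then have "card (padded_group n s k t) =
      card (user_group n s k t) + (s - card (user_group n s k t))"
    unfolding padded_group_def
    by (subst card_Un_disjoint) (auto simp: card_image inj_on_def)
  then show ?thesis using card_user_group_le[OF assms] by simp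
qed

end

theory Submission
  imports Defs "HOL-Real_Asymp.Real_Asymp"
begin

text \<open>Given the hash seed, the bit of group \<open>t\<close> is published as \<open>1\<close> with probability at most
  \<open>k\<^sub>t / s + 1 / (1 + exp \<epsilon>')\<close>, where \<open>k\<^sub>t\<close> counts the lower neighbours in the group, and
  \<open>1 + exp \<epsilon>' = 2 + s * (exp \<epsilon>\<^sub>1 - 1)\<close>. The groups partition the users, so summing over the \<open>m\<close>
  groups bounds the expected number of listed indices by \<open>d\<^sub>i / s + m / (s * (exp \<epsilon>\<^sub>1 - 1))\<close> for
  every seed. Since \<open>n / s \<ge> c > 1\<close>, it remains to see that \<open>m = O(n / s)\<close>, that is, that the
  smallest prime above \<open>n\<close> is \<open>O(n)\<close>.

  This weak form of Bertrand's postulate is obtained as follows. The number \<open>(8 * n) choose (4 * n)\<close> is at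
  least \<open>4 ^ (4 * n) / (8 * n)\<close> and divides every common multiple of \<open>1, \<dots>, 8 * n\<close>. If there were
  no primes between \<open>n\<close> and \<open>8 * n\<close>, the least common multiple would be bounded by the primorial of \<open>n\<close>,
  at most \<open>4 ^ n\<close>, times a factor \<open>8 * n\<close> for each prime up to \<open>sqrt (8 * n)\<close>, which is too small for
  large \<open>n\<close>.\<close>

subsection \<open>A linear bound on the next prime\<close>

lemma prod_primes_dvd:
  fixes N :: nat
  assumes "finite P" "\<And>p. p \<in> P \<Longrightarrow> prime p" "\<And>p. p \<in> P \<Longrightarrow> p dvd N"
  shows "\<Prod>P dvd N"
  using assms
proof (induction P rule: finite_induct)
  case (insert p P)
  have "coprime p (\<Prod>P)"
    using insert by (intro prod_coprime_right) (auto intro!: primes_coprime)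
  then show ?case using insert by (simp add: divides_mult)
qed simp

text \<open>Row 2m + 1 is symmetric, so its lower half sums to 2^(2m), and the coefficient is one
  term of that half.\<close>

lemma odd_central_binomial_le: "(2 * m + 1) choose m \<le> 4 ^ m"
proof -
  have "(2 * m + 1) choose m \<le> (\<Sum>k\<le>m. (2 * m + 1) choose k)"
    by (rule member_le_sum) auto
  then show ?thesis by (simp only: binomial_r_part_sum power_mult) simp
qed

text \<open>Erdos's induction: the primes in (m + 1, 2m + 1] divide (2m + 1)! but neither m! nor (m
  + 1)!, so their product divides the odd central binomial and costs at most 4^m. An even n > 2 adds
  no prime.\<close>

lemma primorial_le: "\<Prod>{p::nat. prime p \<and> p \<le> n} \<le> 4 ^ n"
proof (induction n rule: less_induct)
  case (less n)
  let ?P = "\<lambda>n. {p::nat. prime p \<and> p \<le> n}"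
  consider "n \<le> 2" | m where "n = 2 * m + 1" "m \<ge> 1" | m where "n = 2 * m" "m \<ge> 2"
    by (cases "even n") (force elim!: evenE, force elim!: oddE)
  then show ?case
  proof cases
    case 1
    then have "?P n = (if n = 2 then {2} else {})"
      by (auto dest: prime_ge_2_nat)
    then show ?thesis by simp
  next
    case 2
    let ?Q = "{p::nat. prime p \<and> m + 1 < p \<and> p \<le> 2 * m + 1}"
    have "?P n = ?P (m + 1) \<union> ?Q" using 2 by auto
    then have "\<Prod>(?P n) = \<Prod>(?P (m + 1)) * \<Prod>?Q"
      by (simp only:) (rule prod.union_disjoint; auto)
    also have "\<Prod>?Q dvd (2 * m + 1) choose m"
    proof (rule prod_primes_dvd)
      fix p assume p: "p \<in> ?Q"
      then have "p dvd fact (2 * m + 1)" by (simp add: prime_dvd_fact_iff del: fact_Suc)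
      also have "(fact (2 * m + 1) :: nat) = fact m * fact (m + 1) * ((2 * m + 1) choose m)"
        using binomial_fact_lemma[of m "2 * m + 1"] by (simp add: mult_2 del: fact_Suc)
      finally show "p dvd (2 * m + 1) choose m"
        using p by (simp add: prime_dvd_mult_iff prime_dvd_fact_iff del: fact_Suc)
    qed auto
    then have "\<Prod>?Q \<le> (2 * m + 1) choose m" by (rule dvd_imp_le) simp
    then have "\<Prod>?Q \<le> 4 ^ m" using odd_central_binomial_le le_trans by blast
    then have "\<Prod>(?P (m + 1)) * \<Prod>?Q \<le> 4 ^ (m + 1) * 4 ^ m"
      using less.IH[of "m + 1"] 2 by (intro mult_mono) auto
    also have "\<dots> = 4 ^ n" using 2 by (simp add: power_add mult_2 power_mult_distrib)
    finally show ?thesis .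
  next
    case 3
    then have "\<not> prime n" using prime_product[of 2 m] by auto
    then have "?P n = ?P (n - 1)" using 3 by (auto simp: le_less less_diff_conv elim: le_SucE)
    then have "\<Prod>(?P n) \<le> 4 ^ (n - 1)" using less.IH[of "n - 1"] 3 by simp
    also have "\<dots> \<le> 4 ^ n" by (intro power_increasing) auto
    finally show ?thesis .
  qed
qed

section \<open>Binomial coefficients and common multiples of initial segments\<close>

text \<open>The recurrence of Leibniz's harmonic triangle \<open>1 / (k * (n choose k))\<close>.\<close>

lemma leibniz_triangle:
  assumes "1 \<le> k" "k < n"
  shows "1 / (real (Suc k) * real (n choose Suc k)) =
    1 / (real k * real ((n - 1) choose k)) - 1 / (real k * real (n choose k))"
proof -
  obtain N where n: "n = Suc N" using assms by (cases n) auto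
  have pos: "real (N choose k) > 0" "real (n choose k) > 0" using assms by (auto simp: n)
  have lhs: "real (Suc k) * real (n choose Suc k) = real n * real (N choose k)"
    unfolding n of_nat_mult[symmetric] by (simp only: Suc_times_binomial_eq mult.commute)
  have "real (n - k) * real (n choose k) = real n * real (N choose k)"
    using binomial_absorb_comp[of n k] by (simp only: of_nat_mult[symmetric] n diff_Suc_1)
  then have "(real n - real k) * real (n choose k) = real n * real (N choose k)"
    using assms by (simp add: of_nat_diff)
  then have "1 / real (n choose k) = (real n - real k) / (real n * real (N choose k))"
    using pos assms by (simp add: field_simps)
  then have "1 / (real k * real (N choose k)) - 1 / (real k * real (n choose k)) =
      1 / (real k * real (N choose k)) - (real n - real k) / (real k * (real n * real (N choose k)))"
    by (metis divide_divide_eq_left mult.commute)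
  also have "\<dots> = 1 / (real n * real (N choose k))"
    using pos assms by (simp add: field_simps)
  finally show ?thesis by (simp only: lhs) (simp add: n)
qed

text \<open>By induction on \<open>k\<close>, \<open>D\<close> times an entry of the triangle is an
  integer: column 1 holds 1 / n, and the recurrence writes an entry of column k + 1 as a difference
  of two entries of column k.\<close>

lemma mult_binomial_dvd:
  assumes "1 \<le> k" "k \<le> n" "\<And>j. 1 \<le> j \<Longrightarrow> j \<le> n \<Longrightarrow> j dvd D"
  shows "k * (n choose k) dvd D"
proof -
  have "real D / (real k * real (n choose k)) \<in> \<int>"
    using assms
  proof (induction k arbitrary: n)
    case (Suc k)
    show ?case
    proof (cases "k = 0")
      case True
      have "n dvd D" using Suc.prems by auto
      then obtain q where "D = n * q" ..
      then show ?thesis using True Suc.prems by simp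
    next
      case False
      have "real D / (real (Suc k) * real (n choose Suc k)) =
          real D / (real k * real ((n - 1) choose k)) - real D / (real k * real (n choose k))"
        using arg_cong[OF leibniz_triangle[of k n], of "\<lambda>x. real D * x"] False Suc.prems
        by (simp add: right_diff_distrib)
      moreover have "real D / (real k * real ((n - 1) choose k)) \<in> \<int>"
        using False Suc.prems by (intro Suc.IH) auto
      moreover have "real D / (real k * real (n choose k)) \<in> \<int>"
        using False Suc.prems by (intro Suc.IH) auto
      ultimately show ?thesis by simp
    qed
  qed simp
  then obtain z :: int where "real D / (real k * real (n choose k)) = of_int z"
    by (elim Ints_cases)
  moreover have "real k * real (n choose k) > 0" using assms by simp
  ultimately have "real D = of_int z * (real k * real (n choose k))"
    by (metis less_irrefl nonzero_eq_divide_eq)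
  then have "real_of_int (int D) = real_of_int (int (k * (n choose k)) * z)"
    by simp
  then have "int D = int (k * (n choose k)) * z" by (simp only: of_int_eq_iff)
  then show ?thesis by (metis dvd_triv_left int_dvd_int_iff)
qed

text \<open>Each prime power in the factorization of \<open>j\<close> is at most \<open>M\<close>,
  so its exponent is at most \<open>e p\<close>. This supplies the common multiple \<open>D\<close>
  for \<open>mult_binomial_dvd\<close>.\<close>

lemma dvd_prod_prime_powers:
  fixes e :: "nat \<Rightarrow> nat"
  assumes j: "1 \<le> j" "j \<le> M"
    and e: "\<And>p k. prime p \<Longrightarrow> p ^ k \<le> M \<Longrightarrow> k \<le> e p"
  shows "j dvd (\<Prod>p | prime p \<and> p \<le> M. p ^ e p)"
proof -
  have "j = (\<Prod>p\<in>prime_factors j. p ^ multiplicity p j)"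
    using j by (intro prime_factorization_nat) simp
  also have "\<dots> dvd (\<Prod>p | prime p \<and> p \<le> M. p ^ e p)"
  proof (rule prod_dvd_prod_subset2)
    show "prime_factors j \<subseteq> {p. prime p \<and> p \<le> M}"
      using j by (auto simp: prime_factors_dvd dest!: dvd_imp_le)
    fix p assume "p \<in> prime_factors j"
    moreover have "p ^ multiplicity p j \<le> M"
      using j multiplicity_dvd[of p j] by (meson dvd_imp_le le_trans less_le_trans zero_less_one)
    ultimately show "p ^ multiplicity p j dvd p ^ e p"
      by (intro le_imp_power_dvd e) auto
  qed simp
  finally show ?thesis .
qed

text \<open>A prime whose square exceeds 8n has exponent at most 1 in the common multiple
  \<open>D\<close>. Each of the at most sqrt (8n) other primes gets an extra factor 8n. What remains
  is the product of all primes up to 8n, which by assumption is the primorial of n.\<close>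

lemma central_binomial_le_of_no_primes:
  assumes "n \<ge> 1" "\<And>p. prime p \<Longrightarrow> p \<le> 8 * n \<Longrightarrow> p \<le> n"
  shows "real ((8 * n) choose (4 * n)) \<le> real (8 * n) powr sqrt (real (8 * n)) * 4 ^ n"
proof -
  define M where "M = 8 * n"
  define e where "e p = (GREATEST k. p ^ k \<le> M)" for p :: nat
  let ?P = "{p. prime p \<and> p \<le> M}"
  have P: "?P = {p. prime p \<and> p \<le> n}" using assms by (auto simp: M_def)
  have M: "M \<ge> 8" using assms by (simp add: M_def)
  \<comment> \<open>A crude bound on the exponents, which ensures that the \<open>GREATEST\<close>
    in \<open>e\<close> is attained.\<close>
  have bound: "k \<le> M" if "prime p" "p ^ k \<le> M" for p k :: nat
    using that power_gt_expt[of p k] prime_gt_1_nat[of p] by linarith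
  have e1: "k \<le> e p" if "prime p" "p ^ k \<le> M" for p k
    unfolding e_def by (rule Greatest_le_nat[where b = M]) (use that bound in blast)+
  have e2: "p ^ e p \<le> M" if "prime p" for p
    unfolding e_def
  proof (rule GreatestI_nat[where b = M and k = 0])
    show "p ^ 0 \<le> M" using M by simp
  qed (use that bound in blast)
  define D where "D = (\<Prod>p\<in>?P. p ^ e p)"
  have "4 * n * ((8 * n) choose (4 * n)) dvd D"
    using assms(1) unfolding D_def M_def[symmetric]
    by (intro mult_binomial_dvd dvd_prod_prime_powers e1) (auto simp: M_def)
  moreover have "D > 0" unfolding D_def by (intro prod_pos) (auto dest: prime_gt_0_nat)
  ultimately have "4 * n * ((8 * n) choose (4 * n)) \<le> D" by (intro dvd_imp_le)
  moreover have "1 * ((8 * n) choose (4 * n)) \<le> 4 * n * ((8 * n) choose (4 * n))"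
    using assms by (intro mult_right_mono) auto
  ultimately have "(8 * n) choose (4 * n) \<le> D" by linarith
  also have "D \<le> (\<Prod>p\<in>?P. (if p\<^sup>2 \<le> M then M else 1) * p)"
    unfolding D_def
  proof (rule prod_mono)
    fix p assume "p \<in> ?P"
    then have p: "prime p" "p \<ge> 1" by (auto dest: prime_ge_1_nat)
    have "p ^ e p \<le> (if p\<^sup>2 \<le> M then M else 1) * p"
    proof (cases "p\<^sup>2 \<le> M")
      case True
      have "p ^ e p * 1 \<le> M * p" using p e2[OF p(1)] by (intro mult_le_mono)
      then show ?thesis using True by simp
    next
      case False
      have "e p < 2"
      proof (rule ccontr)
        assume "\<not> e p < 2"
        then have "p\<^sup>2 \<le> p ^ e p" using p(2) by (intro power_increasing) simp_all
        then show False using False e2[OF p(1)] by linarith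
      qed
      then have "p ^ e p \<le> p ^ 1" using p(2) by (intro power_increasing) simp_all
      then show ?thesis using False by simp
    qed
    then show "0 \<le> p ^ e p \<and> p ^ e p \<le> (if p\<^sup>2 \<le> M then M else 1) * p" by simp
  qed
  also have "\<dots> = M ^ card {p \<in> ?P. p\<^sup>2 \<le> M} * \<Prod>?P"
    by (simp add: prod.distrib prod.If_cases Int_def)
  also have "\<dots> \<le> M ^ card {p \<in> ?P. p\<^sup>2 \<le> M} * 4 ^ n"
    using primorial_le[of n] P by (intro mult_left_mono) auto
  finally have "real ((8 * n) choose (4 * n)) \<le> real (M ^ card {p \<in> ?P. p\<^sup>2 \<le> M} * 4 ^ n)"
    by (rule of_nat_mono)
  also have "\<dots> = real M powr real (card {p \<in> ?P. p\<^sup>2 \<le> M}) * 4 ^ n"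
    using M by (simp add: powr_realpow)
  also have "\<dots> \<le> real M powr sqrt (real M) * 4 ^ n"
  proof (intro mult_right_mono powr_mono)
    have "{p \<in> ?P. p\<^sup>2 \<le> M} \<subseteq> {1..nat \<lfloor>sqrt (real M)\<rfloor>}"
    proof
      fix p assume p: "p \<in> {p \<in> ?P. p\<^sup>2 \<le> M}"
      then have "real p ^ 2 \<le> real M" by (metis (mono_tags) mem_Collect_eq of_nat_le_iff of_nat_power)
      then have "real p \<le> sqrt (real M)" by (rule real_le_rsqrt)
      then show "p \<in> {1..nat \<lfloor>sqrt (real M)\<rfloor>}"
        using p prime_ge_1_nat by (auto simp: le_nat_floor)
    qed
    then have "card {p \<in> ?P. p\<^sup>2 \<le> M} \<le> nat \<lfloor>sqrt (real M)\<rfloor>"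
      by (metis card_atLeastAtMost card_mono diff_Suc_1 finite_atLeastAtMost)
    then show "real (card {p \<in> ?P. p\<^sup>2 \<le> M}) \<le> sqrt (real M)"
      by (simp add: le_nat_iff le_floor_iff)
  qed (use M in auto)
  finally show ?thesis by (simp add: M_def)
qed

section \<open>Existence of primes between n and 8n\<close>

lemma eventually_prime_le_mult8:
  "eventually (\<lambda>n::nat. \<exists>p. prime p \<and> n < p \<and> p \<le> 8 * n) sequentially"
proof -
  \<comment> \<open>The left side is 4^(n + o(n)), since sqrt (8n) * ln (8n) = o(n); the right side
    is 4^(4n - o(n)). Row 2n would give 4^n on both sides, hence the longer row 8n.\<close>
  have "eventually (\<lambda>n::nat. real (8 * n) powr sqrt (real (8 * n)) * 4 ^ n
      < 4 ^ (4 * n) / (2 * real (4 * n))) sequentially"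
    by real_asymp
  then show ?thesis using eventually_ge_at_top[of 1]
  proof eventually_elim
    case (elim n)
    show ?case
    proof (rule ccontr)
      assume "\<not> ?thesis"
      then have "real ((8 * n) choose (4 * n)) \<le> real (8 * n) powr sqrt (real (8 * n)) * 4 ^ n"
        using elim by (intro central_binomial_le_of_no_primes) (auto simp: not_less)
      moreover have "4 ^ (4 * n) / (2 * real (4 * n)) \<le> real ((8 * n) choose (4 * n))"
        using central_binomial_lower_bound[of "4 * n"] elim by simp
      ultimately show False using elim by linarith
    qed
  qed
qed

lemma next_prime_le_linear:
  obtains K :: nat where "\<And>n. n \<ge> 1 \<Longrightarrow> next_prime n \<le> K * n"
proof -
  obtain N where N: "\<And>n. n \<ge> N \<Longrightarrow> \<exists>p::nat. prime p \<and> n < p \<and> p \<le> 8 * n"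
    using eventually_prime_le_mult8 by (auto simp: eventually_sequentially)
  have least: "next_prime n \<le> p" if "prime p" "n < p" for n p
    unfolding next_prime_def using that by (intro Least_le) auto
  \<comment> \<open>Below the threshold \<open>N\<close>, the prime above \<open>N\<close> also
    exceeds n, so adding \<open>next_prime N\<close> to the constant covers these cases.\<close>
  have "next_prime n \<le> (next_prime N + 8) * n" if "n \<ge> 1" for n
  proof (cases "n \<ge> N")
    case True
    then obtain p where "prime p" "n < p" "p \<le> 8 * n" using N by blast
    then show ?thesis using least[of p n] by (simp add: add_mult_distrib)
  next
    case False
    then have "next_prime n \<le> next_prime N * 1" using next_prime[of N] by (simp add: least)
    also have "\<dots> \<le> (next_prime N + 8) * n" using that by (intro mult_mono) auto
    finally show ?thesis .
  qed
  then show thesis using that by blast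
qed

subsection \<open>The expected number of listed indices\<close>

text \<open>The mechanism masks only indices above \<open>i\<close>, while the degree counts indices
  below \<open>i\<close>; absence of loops reconciles the two.\<close>

lemma neighbours_le_eq_lower_neighbours:
  assumes "simple_graph n E" "i \<in> {1..n}"
  shows "{j \<in> {1..n}. j \<le> i \<and> adj E i j} = {j \<in> {1..<i}. adj E i j}"
proof -
  have "\<not> adj E i i"
    using assms(1) by (fastforce simp: simple_graph_def adj_def doubleton_eq_iff)
  then show ?thesis using assms(2) by (auto simp: le_less)
qed

text \<open>Dummies carry bit 0 and different values of \<open>t\<close> give disjoint groups, so
  each lower neighbour is counted at most once.\<close>

lemma sum_card_input_bits_le:
  assumes "simple_graph n E" "i \<in> {1..n}"
  shows "(\<Sum>t<m. card {c \<in> padded_group n s k t. input_bit E i c}) \<le> low_degree E i"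
proof -
  let ?N = "\<lambda>t. {j \<in> user_group n s k t. j \<le> i \<and> adj E i j}"
  have "{c \<in> padded_group n s k t. input_bit E i c} = User ` ?N t" for t
    by (auto simp: padded_group_def)
  then have "(\<Sum>t<m. card {c \<in> padded_group n s k t. input_bit E i c}) = (\<Sum>t<m. card (?N t))"
    by (simp add: card_image inj_on_def)
  also have "\<dots> = card (\<Union>t<m. ?N t)"
    by (rule card_UN_disjoint[symmetric]) (auto simp: user_group_def)
  also have "\<dots> \<le> card {j \<in> {1..n}. j \<le> i \<and> adj E i j}"
    by (intro card_mono) (auto simp: user_group_def)
  finally show ?thesis by (simp only: neighbours_le_eq_lower_neighbours[OF assms] low_degree_def)
qed

text \<open>Exact for a 0 bit; for a 1 bit the probability is simply bounded by 1.\<close>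

lemma expectation_randomized_response_le:
  "measure_pmf.expectation (randomized_response \<epsilon> b) of_bool
     \<le> (of_bool b + 1 / (1 + exp \<epsilon>) :: real)"
proof -
  have "exp \<epsilon> / (1 + exp \<epsilon>) \<in> {0..1}" "1 - exp \<epsilon> / (1 + exp \<epsilon>) = 1 / (1 + exp \<epsilon>)"
    by (auto simp: divide_simps add_pos_pos add_nonneg_eq_0_iff)
  then show ?thesis
    by (cases b) (auto simp: randomized_response_def add_increasing2)
qed

lemma expectation_published_bit_le:
  assumes "s > 0" "k \<in> {1..next_prime n - 1} \<times> {0..next_prime n - 1}"
  shows "measure_pmf.expectation (published_bit n s \<epsilon> E i k t) of_bool
     \<le> real (card {c \<in> padded_group n s k t. input_bit E i c}) / real s
         + 1 / (1 + exp (rr_budget s \<epsilon>))"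
proof -
  let ?G = "padded_group n s k t"
  have card: "card ?G = s" using card_padded_group[OF assms] .
  then have G: "finite ?G" "?G \<noteq> {}" using assms(1) card_gt_0_iff by metis+
  have "measure_pmf.expectation (published_bit n s \<epsilon> E i k t) of_bool =
      (\<Sum>c\<in>?G. measure_pmf.expectation (randomized_response (rr_budget s \<epsilon>) (input_bit E i c))
        of_bool / real s)"
    unfolding published_bit_def using G
    by (subst pmf_expectation_bind_pmf_of_set) (auto simp: card divide_inverse mult.commute)
  also have "\<dots> \<le> (\<Sum>c\<in>?G. (of_bool (input_bit E i c) + 1 / (1 + exp (rr_budget s \<epsilon>))) / real s)"
    by (intro sum_mono divide_right_mono expectation_randomized_response_le) simp
  also have "\<dots> = (\<Sum>c\<in>?G. of_bool (input_bit E i c)) / real s + 1 / (1 + exp (rr_budget s \<epsilon>))"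
    using assms(1) by (simp add: card sum.distrib add_divide_distrib flip: sum_divide_distrib)
  also have "(\<Sum>c\<in>?G. of_bool (input_bit E i c)) = real (card {c \<in> ?G. input_bit E i c})"
    using G by (simp add: sum.If_cases Int_def of_bool_def)
  finally show ?thesis .
qed

lemma length_filter_upt: "length (filter f [0..<m]) = (\<Sum>t<m. of_bool (f t))"
  by (induction m) auto

text \<open>For a fixed seed, linearity of expectation reduces the length to the marginals of the
  single bits. The resulting bound is the same for every seed and so survives averaging.\<close>

lemma expectation_upload_length_le:
  assumes s: "s > 0" and E: "simple_graph n E" "i \<in> {1..n}"
  shows "measure_pmf.expectation (upload n s \<epsilon> E i) (\<lambda>ts. real (length ts))
     \<le> real (low_degree E i) / real s + real (num_groups n s) / (1 + exp (rr_budget s \<epsilon>))"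
    (is "_ \<le> ?B")
proof -
  define K where "K = {1..next_prime n - 1} \<times> {0..next_prime n - 1}"
  define m where "m = num_groups n s"
  define bits where "bits k = Pi_pmf {..<m} False (published_bit n s \<epsilon> E i k)" for k
  define listed where "listed k = map_pmf (\<lambda>a'. filter a' [0..<m]) (bits k)" for k
  have K: "finite K" "K \<noteq> {}"
    using prime_ge_2_nat[OF next_prime(1)[of n]] by (auto simp: K_def)
  have bound: "measure_pmf.expectation (listed k) (\<lambda>ts. real (length ts)) \<le> ?B"
    if k: "k \<in> K" for k
  proof -
    have "measure_pmf.expectation (listed k) (\<lambda>ts. real (length ts)) =
        measure_pmf.expectation (bits k) (\<lambda>a'. \<Sum>t<m. of_bool (a' t))"
      by (simp add: listed_def length_filter_upt)
    also have "\<dots> = (\<Sum>t<m. measure_pmf.expectation (bits k) (\<lambda>a'. of_bool (a' t)))"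
      by (rule Bochner_Integration.integral_sum)
         (auto intro!: measure_pmf.integrable_const_bound[of _ 1])
    also have "\<dots> = (\<Sum>t<m. measure_pmf.expectation (map_pmf (\<lambda>a'. a' t) (bits k)) of_bool)"
      by simp
    also have "\<dots> = (\<Sum>t<m. measure_pmf.expectation (published_bit n s \<epsilon> E i k t) of_bool)"
      unfolding bits_def by (intro sum.cong refl, subst Pi_pmf_component) auto
    also have "\<dots> \<le> (\<Sum>t<m. real (card {c \<in> padded_group n s k t. input_bit E i c}) / real s
         + 1 / (1 + exp (rr_budget s \<epsilon>)))"
      using k s unfolding K_def by (intro sum_mono expectation_published_bit_le)
    also have "\<dots> = real (\<Sum>t<m. card {c \<in> padded_group n s k t. input_bit E i c}) / real s
         + real m / (1 + exp (rr_budget s \<epsilon>))"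
      by (simp add: sum.distrib sum_divide_distrib)
    also have "\<dots> \<le> ?B"
      using sum_card_input_bits_le[OF E, of s k m] unfolding m_def
      by (intro add_right_mono divide_right_mono of_nat_mono) auto
    finally show ?thesis .
  qed
  \<comment> \<open>Finite support is a premise of
    \<open>pmf_expectation_bind_pmf_of_set\<close>.\<close>
  have fin: "finite (set_pmf (listed k))" for k
    unfolding listed_def
    by (rule finite_subset[of _ "{xs. set xs \<subseteq> {..<m} \<and> length xs \<le> m}"])
       (auto intro: finite_lists_length_le order.trans[OF length_filter_le])
  have "upload n s \<epsilon> E i = pmf_of_set K \<bind> listed"
    by (simp add: upload_def hash_seed_def K_def listed_def[abs_def] bits_def m_def map_pmf_def)
  then have "measure_pmf.expectation (upload n s \<epsilon> E i) (\<lambda>ts. real (length ts)) =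
      (\<Sum>k\<in>K. measure_pmf.expectation (listed k) (\<lambda>ts. real (length ts)) / real (card K))"
    using K fin by (simp add: pmf_expectation_bind_pmf_of_set divide_inverse mult.commute)
  also have "\<dots> \<le> (\<Sum>k\<in>K. ?B / real (card K))"
    by (intro sum_mono divide_right_mono bound) auto
  also have "\<dots> = ?B" using K by simp
  finally show ?thesis .
qed

section \<open>Choice of the constants and the final estimate\<close>

theorem theorem6:
  fixes c :: real
  assumes "c > 1"
  shows "\<exists>C > 0. \<forall>(n :: nat) (s :: nat) (\<epsilon>\<^sub>1 :: real) (E :: nat set set) (i :: nat).
    s \<ge> 1 \<and> real n \<ge> c * real s \<and> \<epsilon>\<^sub>1 > 0 \<and> simple_graph n E \<and> i \<in> {1..n} \<longrightarrow>
    upload_cost n s \<epsilon>\<^sub>1 E i \<le>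
      C * ((real (low_degree E i) / real s + real n / ((real s)\<^sup>2 * (exp \<epsilon>\<^sub>1 - 1)))
           * log 2 (real n / real s))"
proof -
  obtain K :: nat where K: "\<And>n. n \<ge> 1 \<Longrightarrow> next_prime n \<le> K * n"
    by (rule next_prime_le_linear) blast
  \<comment> \<open>\<open>A\<close> bounds m / (n / s): \<open>K\<close> comes from the next prime,
    1 from the ceiling, as n / s >= 1. \<open>B\<close> turns log A + log (n / s) into a multiple of
    log (n / s), using log (n / s) >= log c > 0.\<close>
  define A where "A = real K + 1"
  define B where "B = log 2 A / log 2 c + 1"
  have A: "A \<ge> 1" by (simp add: A_def)
  have B: "B \<ge> 1" using A assms by (simp add: B_def)
  have "upload_cost n s \<epsilon> E i \<le> A * B *
      ((real (low_degree E i) / real s + real n / ((real s)\<^sup>2 * (exp \<epsilon> - 1))) * log 2 (real n / real s))"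
    if s: "s \<ge> 1" and n: "real n \<ge> c * real s" and \<epsilon>: "\<epsilon> > 0"
      and E: "simple_graph n E" "i \<in> {1..n}" for n s i :: nat and \<epsilon> :: real and E
  proof -
    define x where "x = real n / real s"
    define m where "m = num_groups n s"
    define d where "d = real (low_degree E i)"
    define \<delta> where "\<delta> = exp \<epsilon> - 1"
    have \<delta>: "\<delta> > 0" using \<epsilon> by (simp add: \<delta>_def)
    have x: "x \<ge> c" using n s by (simp add: x_def field_simps)
    have p: "next_prime n \<ge> 1" using next_prime(2)[of n] by simp
    then have "real (next_prime n) / real s > 0" using s by simp
    \<comment> \<open>This makes log m nonnegative, as the final multiplication of the two bounds
      requires.\<close>
    then have m1: "m \<ge> 1" unfolding m_def num_groups_def by linarith
    have "real (next_prime n) \<le> real K * real n"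
      using K[of n] E(2) by (metis atLeastAtMost_iff le_trans of_nat_le_iff of_nat_mult)
    then have "real (next_prime n) / real s \<le> real K * x"
      using s by (simp add: x_def divide_right_mono)
    moreover have "real m \<le> real (next_prime n) / real s + 1"
      unfolding m_def num_groups_def using \<open>real (next_prime n) / real s > 0\<close> by linarith
    ultimately have m: "real m \<le> A * x"
      using x assms by (simp add: A_def distrib_right)
    have "log 2 (real m) \<le> log 2 (A * x)" using m m1 by simp
    also have "\<dots> = log 2 A + log 2 x" using A x assms by (simp add: log_mult)
    also have "log 2 A \<le> log 2 A / log 2 c * log 2 x"
    proof -
      have "log 2 A * log 2 c \<le> log 2 A * log 2 x" using A x assms by (intro mult_left_mono) auto
      then show ?thesis using assms by (simp add: field_simps)
    qed
    finally have logm: "log 2 (real m) \<le> B * log 2 x" by (simp add: B_def distrib_right)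
    \<comment> \<open>The budget is chosen so that its exponential is 1 + s *
      \<open>\<delta>\<close>; dropping the 2 then leaves the denominator of the claim.\<close>
    have "1 + exp (rr_budget s \<epsilon>) = 2 + real s * \<delta>"
      using \<delta> s unfolding rr_budget_def \<delta>_def[symmetric] by (subst exp_ln) (auto intro: add_pos_nonneg)
    then have "real m / (1 + exp (rr_budget s \<epsilon>)) \<le> A * x / (real s * \<delta>)"
      using m s \<delta> A x assms by (intro frac_le) auto
    also have "\<dots> = A * (real n / ((real s)\<^sup>2 * \<delta>))" by (simp add: x_def power2_eq_square)
    finally have "real m / (1 + exp (rr_budget s \<epsilon>)) \<le> A * (real n / ((real s)\<^sup>2 * \<delta>))" .
    moreover have "d / real s \<le> A * (d / real s)"
      using A mult_right_mono[of 1 A "d / real s"] by (simp add: d_def)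
    ultimately have "d / real s + real m / (1 + exp (rr_budget s \<epsilon>))
        \<le> A * (d / real s + real n / ((real s)\<^sup>2 * \<delta>))"
      by (simp add: distrib_left)
    then have len: "measure_pmf.expectation (upload n s \<epsilon> E i) (\<lambda>ts. real (length ts))
        \<le> A * (d / real s + real n / ((real s)\<^sup>2 * \<delta>))"
      using expectation_upload_length_le[OF _ E, of s \<epsilon>] s unfolding d_def m_def by linarith
    have "upload_cost n s \<epsilon> E i =
        measure_pmf.expectation (upload n s \<epsilon> E i) (\<lambda>ts. real (length ts)) * log 2 (real m)"
      by (simp add: upload_cost_def m_def)
    also have "\<dots> \<le> (A * (d / real s + real n / ((real s)\<^sup>2 * \<delta>))) * (B * log 2 x)"
      using len logm m1 A \<delta> by (intro mult_mono) (auto simp: d_def)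
    finally show ?thesis by (simp add: d_def \<delta>_def x_def mult_ac)
  qed
  moreover have "A * B > 0" using A B by simp
  ultimately show ?thesis by blast
qed

end
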